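(* Let $\xi=(\xi_t)_{t\in\mathbb{R}_+}$ be a finitely additive stochastic process on $(\mathcal{A}_t)_{t\in\mathbb{R}_+}$. Then $\xi\in\mathfrak{S}$ if and only if there exist $\bar x\in\mathfrak{M}$ and $\lambda\in ba(\mathcal{A}_\infty)$ such that $$\xi_t(F)=\lambda(F)+\bar x\big(F\times]t,\infty[\big)\qquad\text{for all } t\in\mathbb{R}_+,\ F\in\mathcal{A}_t .$$
   Context: $\Omega$ is a set and $(\mathcal{A}_t)_{t\in\mathbb{R}_+}$ is an increasing family of algebras of subsets of $\Omega$; $\mathcal{A}_\infty=\mathcal{A}=\bigcup_{t\in\mathbb{R}_+}\mathcal{A}_t$. For an algebra $\mathcal{G}$ of sets, $ba(\mathcal{G})$ is the space of bounded finitely additive real-valued set functions on $\mathcal{G}$ with the total variation norm, and $ba(\mathcal{G})_+$ its positive elements. A finitely additive stochastic process is a family $\xi=(\xi_t)_{t\in\mathbb{R}_+}$ with $\xi_t\in ba(\mathcal{A}_t)$ for every $t$. It is a finitely additive supermartingale if $\xi_t(F)\ge\xi_u(F)$ whenever $t\le u$ and $F\in\mathcal{A}_t$. $\mathfrak{S}$ is the set of finitely additive supermartingales $\xi$ with $\sup_{t\in\mathbb{R}_+}\|\xi_t\|<\infty$. Put $\overline{\mathbb{R}}_+=\mathbb{R}_+\cup\{\infty\}$, $\bar\Omega=\Omega\times\overline{\mathbb{R}}_+$, and $$\mathfrak{M}=\Big\{\bar x\in ba\big(2^{\bar\Omega}\big)_+:\ \lim_{t\to\infty}\bar x\big(\Omega\times]t,\infty[\big)=0\Big\}.$$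 *)

theory Defs
  imports "HOL-Analysis.Analysis"
begin

text \<open>
  Set functions on a family \<open>G\<close> of sets are represented by total functions; only their values
  on \<open>G\<close> matter. The index set $\mathbb{R}_+$ is \<open>{0..} :: real set\<close>, so values at
  negative times are irrelevant.
\<close>

definition ba :: "'a set set \<Rightarrow> ('a set \<Rightarrow> real) set"
  where "ba G = {\<mu>. Measure_Space.additive G \<mu> \<and> bounded (\<mu> ` G)}"

definition ba_plus :: "'a set set \<Rightarrow> ('a set \<Rightarrow> real) set"
  where "ba_plus G = {\<mu> \<in> ba G. \<forall>F\<in>G. 0 \<le> \<mu> F}"

text \<open>
  Taken in \<open>ennreal\<close>, so that no boundedness is presupposed by the supremum.
\<close>

definition tv_norm :: "'a set set \<Rightarrow> ('a set \<Rightarrow> real) \<Rightarrow> ennreal"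
  where "tv_norm G \<mu> =
    (SUP P\<in>{P. finite P \<and> P \<subseteq> G \<and> disjoint P}. \<Sum>F\<in>P. ennreal \<bar>\<mu> F\<bar>)"

locale algebra_filtration =
  fixes \<Omega> :: "'a set" and \<A> :: "real \<Rightarrow> 'a set set"
  assumes algebra: "0 \<le> t \<Longrightarrow> algebra \<Omega> (\<A> t)"
    and increasing: "0 \<le> t \<Longrightarrow> t \<le> u \<Longrightarrow> \<A> t \<subseteq> \<A> u"

definition alg_infinity :: "(real \<Rightarrow> 'a set set) \<Rightarrow> 'a set set"
  where "alg_infinity \<A> = (\<Union>t\<in>{0..}. \<A> t)"

definition fa_process :: "(real \<Rightarrow> 'a set set) \<Rightarrow> (real \<Rightarrow> 'a set \<Rightarrow> real) set"
  where "fa_process \<A> = {\<xi>. \<forall>t\<ge>0. \<xi> t \<in> ba (\<A> t)}"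

definition fa_supermartingale :: "(real \<Rightarrow> 'a set set) \<Rightarrow> (real \<Rightarrow> 'a set \<Rightarrow> real) set"
  where "fa_supermartingale \<A> =
    {\<xi> \<in> fa_process \<A>. \<forall>t u F. 0 \<le> t \<longrightarrow> t \<le> u \<longrightarrow> F \<in> \<A> t \<longrightarrow> \<xi> t F \<ge> \<xi> u F}"

definition bounded_fa_supermartingale ::
    "(real \<Rightarrow> 'a set set) \<Rightarrow> (real \<Rightarrow> 'a set \<Rightarrow> real) set"
  where "bounded_fa_supermartingale \<A> =
    {\<xi> \<in> fa_supermartingale \<A>. (SUP t\<in>{0..}. tv_norm (\<A> t) (\<xi> t)) < \<infinity>}"

text \<open>
  The type \<open>ennreal\<close> plays the role of $\overline{\mathbb{R}}_+ = \mathbb{R}_+ \cup \{\infty\}$.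
  The intervals \<open>{ennreal t<..<\<infinity>}\<close> exclude the point \<open>\<infinity>\<close>.
\<close>

definition Omega_bar :: "'a set \<Rightarrow> ('a \<times> ennreal) set"
  where "Omega_bar \<Omega> = \<Omega> \<times> UNIV"

definition frakM :: "'a set \<Rightarrow> (('a \<times> ennreal) set \<Rightarrow> real) set"
  where "frakM \<Omega> =
    {x \<in> ba_plus (Pow (Omega_bar \<Omega>)).
      ((\<lambda>t::real. x (\<Omega> \<times> {ennreal t<..<\<infinity>})) \<longlongrightarrow> 0) at_top}"

end

theory Submission
  imports Defs
begin

text \<open>
  This is a finitely additive Doob-Meyer decomposition. Call a finitely additive bounded set
  function a charge.

  If \<open>\<xi>\<close> has the stated form, then it decreases in time because the intervals shrink and \<open>x\<close> is
  positive, and its values are bounded by a constant that does not depend on the time. A bound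
  on the values of a charge on an algebra gives twice that bound on its total variation
  (\<open>tv_norm_le\<close>), so the norms are bounded too.

  Conversely, a norm-bounded supermartingale decreases on each set \<open>F\<close> to a limit \<open>\<mu> F\<close>, and \<open>\<mu>\<close>
  is a charge on the union of the algebras (\<open>bounded_fa_supermartingale_limit\<close>). The remainder
  \<open>\<eta> t = \<xi> t - \<mu>\<close> is positive and decreases to zero. It has to be written as
  \<open>\<eta> t F = x (F \<times> {ennreal t<..<\<infinity>})\<close> for a single positive charge \<open>x\<close>; the limit condition on \<open>x\<close>
  then says no more than that \<open>\<eta> t \<Omega>\<close> tends to zero. For finitely many times such an \<open>x\<close> is
  built by hand: the mass that \<open>\<eta>\<close> loses between two consecutive times is placed on one time
  slice between them, and what is left at the last time on a later slice
  (\<open>decreasing_charges_represented_finite\<close>). All times together are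
  reached by compactness (\<open>ba_plus_prescribed_values_compact\<close>), since positivity, finite
  additivity and prescribed values all pass to pointwise limits. The same compactness argument extends a positive charge from an algebra to
  all sets (\<open>algebra_charge_extension\<close>), which the slices need.
\<close>

section \<open>Finitely additive set functions\<close>

lemma ba_plus_UNIV_I:
  assumes "\<And>A B. A \<inter> B = {} \<Longrightarrow> x (A \<union> B) = x A + x B" and "\<And>E. 0 \<le> x E"
  shows "x \<in> ba_plus UNIV"
proof -
  have "x E \<le> x UNIV" for E
    using assms(1)[of E "- E"] assms(2)[of "- E"] by simp
  then have "\<bar>x E\<bar> \<le> x UNIV" for E
    using assms(2)[of E] by simp
  then have "bounded (range x)"
    by (auto simp: bounded_iff)
  then show ?thesis
    using assms by (auto simp: ba_plus_def ba_def Measure_Space.additive_def)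
qed

lemma
  assumes "x \<in> ba_plus UNIV"
  shows ba_plus_UNIV_Un: "A \<inter> B = {} \<Longrightarrow> x (A \<union> B) = x A + x B"
    and ba_plus_UNIV_nonneg: "0 \<le> x E"
    and ba_plus_UNIV_le: "x E \<le> x UNIV"
proof -
  show un: "A \<inter> B = {} \<Longrightarrow> x (A \<union> B) = x A + x B" for A B
    using assms by (auto simp: ba_plus_def ba_def Measure_Space.additive_def)
  show nn: "0 \<le> x E" for E
    using assms by (auto simp: ba_plus_def)
  show "x E \<le> x UNIV"
    using un[of E "- E"] nn[of "- E"] by simp
qed

lemma algebra_additive_empty:
  fixes \<mu> :: "'a set \<Rightarrow> real"
  assumes "algebra \<Omega> G" "Measure_Space.additive G \<mu>"
  shows "\<mu> {} = 0"
proof -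
  interpret algebra \<Omega> G by fact
  show ?thesis
    using additiveD[OF assms(2), of "{}" "{}"] by simp
qed

lemma algebra_additive_sum:
  fixes \<mu> :: "'a set \<Rightarrow> real"
  assumes "algebra \<Omega> G" "Measure_Space.additive G \<mu>"
    and "finite I" "\<And>i. i \<in> I \<Longrightarrow> A i \<in> G" "disjoint_family_on A I"
  shows "(\<Sum>i\<in>I. \<mu> (A i)) = \<mu> (\<Union>i\<in>I. A i)"
  using assms(3-5)
proof (induction I)
  case empty
  show ?case using algebra_additive_empty[OF assms(1,2)] by simp
next
  case (insert i I)
  interpret algebra \<Omega> G by fact
  have "A i \<inter> (\<Union>j\<in>I. A j) = {}"
    using insert.hyps(2) insert.prems(2) by (fastforce simp: disjoint_family_on_def)
  moreover have "(\<Union>j\<in>I. A j) \<in> G"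
    using insert.hyps(1) insert.prems(1) by (intro finite_UN) auto
  moreover have "disjoint_family_on A I"
    using insert.prems(2) by (rule disjoint_family_on_mono[rotated]) auto
  ultimately show ?case
    using insert additiveD[OF assms(2), of "A i" "\<Union>j\<in>I. A j"] by simp
qed

text \<open>
  The members of a disjoint family on which \<open>\<mu>\<close> is positive have a union whose mass is the
  sum of their masses, and likewise for the negative ones; so each half contributes at most \<open>C\<close>.
  A uniform bound on values is thus as good as one on total variation.
\<close>

lemma tv_norm_le:
  assumes "algebra \<Omega> G" "Measure_Space.additive G \<mu>" and bd: "\<And>F. F \<in> G \<Longrightarrow> \<bar>\<mu> F\<bar> \<le> C"
  shows "tv_norm G \<mu> \<le> ennreal (2 * C)"
  unfolding tv_norm_def
proof (rule SUP_least)
  interpret algebra \<Omega> G by fact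
  fix P assume "P \<in> {P. finite P \<and> P \<subseteq> G \<and> disjoint P}"
  then have P: "finite P" "P \<subseteq> G" "disjoint P" by auto
  have sum_eq: "(\<Sum>F\<in>Q. \<mu> F) = \<mu> (\<Union>Q)" "\<Union>Q \<in> G" if "Q \<subseteq> P" for Q
  proof -
    have "finite Q" "Q \<subseteq> G" using that P finite_subset by auto
    moreover have "disjoint_family_on (\<lambda>F. F) Q"
      using P(3) that by (auto simp: disjoint_family_on_def disjoint_def)
    ultimately show "(\<Sum>F\<in>Q. \<mu> F) = \<mu> (\<Union>Q)"
      using algebra_additive_sum[OF assms(1,2), of Q "\<lambda>F. F"] by (simp add: subset_iff)
    show "\<Union>Q \<in> G" using \<open>finite Q\<close> \<open>Q \<subseteq> G\<close> by blast
  qed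
  let ?N = "{F \<in> P. \<mu> F < 0}"
  have "(\<Sum>F\<in>P. \<bar>\<mu> F\<bar>) = (\<Sum>F\<in>P - ?N. \<bar>\<mu> F\<bar>) + (\<Sum>F\<in>?N. \<bar>\<mu> F\<bar>)"
    using P(1) by (intro sum.subset_diff) auto
  also have "\<dots> = (\<Sum>F\<in>P - ?N. \<mu> F) - (\<Sum>F\<in>?N. \<mu> F)"
  proof -
    have "(\<Sum>F\<in>P - ?N. \<bar>\<mu> F\<bar>) = (\<Sum>F\<in>P - ?N. \<mu> F)"
      by (rule sum.cong) auto
    moreover have "(\<Sum>F\<in>?N. \<bar>\<mu> F\<bar>) = (\<Sum>F\<in>?N. - \<mu> F)"
      by (rule sum.cong) auto
    ultimately show ?thesis by (simp add: sum_negf)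
  qed
  also have "\<dots> = \<mu> (\<Union>(P - ?N)) - \<mu> (\<Union>?N)"
    using sum_eq[of "P - ?N"] sum_eq[of ?N] by auto
  also have "\<dots> \<le> 2 * C"
    using bd[OF sum_eq(2)[of "P - ?N"]] bd[OF sum_eq(2)[of ?N]] by auto
  finally have "(\<Sum>F\<in>P. \<bar>\<mu> F\<bar>) \<le> 2 * C" .
  then show "(\<Sum>F\<in>P. ennreal \<bar>\<mu> F\<bar>) \<le> ennreal (2 * C)"
    by (simp add: sum_ennreal ennreal_leI)
qed

section \<open>Compactness of charges and extension from an algebra\<close>

text \<open>
  By Tychonoff the functions from sets to \<open>{0..B}\<close> form a compact space for pointwise
  convergence. Additivity and each prescribed value are closed conditions, so the finite
  intersection property turns solvability of finitely many prescriptions into solvability of all.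
\<close>

lemma ba_plus_prescribed_values_compact:
  fixes E :: "'i \<Rightarrow> 'b set" and c :: "'i \<Rightarrow> real"
  assumes fin: "\<And>K. finite K \<Longrightarrow> K \<subseteq> I \<Longrightarrow>
    \<exists>x\<in>ba_plus UNIV. x UNIV \<le> B \<and> (\<forall>i\<in>K. x (E i) = c i)"
  shows "\<exists>x\<in>ba_plus UNIV. \<forall>i\<in>I. x (E i) = c i"
proof -
  let ?box = "PiE UNIV (\<lambda>_::'b set. {0..B})"
  define S where "S = ?box \<inter> {x. \<forall>A A'. A \<inter> A' = {} \<longrightarrow> x (A \<union> A') = x A + x A'}"
  have "compactin (product_topology (\<lambda>_::'b set. euclideanreal) UNIV) ?box"
    by (subst compactin_PiE) auto
  then have "compact ?box"
    by (simp add: euclidean_product_topology)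
  moreover have "closed {x::'b set \<Rightarrow> real. \<forall>A A'. A \<inter> A' = {} \<longrightarrow> x (A \<union> A') = x A + x A'}"
    by (intro closed_Collect_all closed_Collect_imp closed_Collect_eq open_Collect_const
        continuous_on_add continuous_on_product_coordinates)
  ultimately have "compact S"
    unfolding S_def by (rule compact_Int_closed)
  have inS: "x \<in> S \<longleftrightarrow> x \<in> ba_plus UNIV \<and> x UNIV \<le> B" for x
  proof
    assume "x \<in> S"
    then show "x \<in> ba_plus UNIV \<and> x UNIV \<le> B"
      by (auto simp: S_def intro!: ba_plus_UNIV_I)
  next
    assume "x \<in> ba_plus UNIV \<and> x UNIV \<le> B"
    then show "x \<in> S"
      using ba_plus_UNIV_Un[of x] ba_plus_UNIV_nonneg[of x] ba_plus_UNIV_le[of x]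
      by (auto simp: S_def) (metis order_trans)
  qed
  have "S \<inter> (\<Inter>i\<in>I. {x. x (E i) = c i}) \<noteq> {}"
  proof (rule compact_imp_fip_image[OF \<open>compact S\<close>])
    show "closed {x. x (E i) = c i}" for i
      by (intro closed_Collect_eq continuous_on_product_coordinates continuous_on_const)
    fix K assume "finite K" "K \<subseteq> I"
    from fin[OF this] show "S \<inter> (\<Inter>i\<in>K. {x. x (E i) = c i}) \<noteq> {}"
      using inS by blast
  qed
  then show ?thesis
    using inS by blast
qed

lemma algebra_atom:
  assumes "algebra \<Omega> G" "finite K" "K \<subseteq> G"
  shows "{\<omega>\<in>\<Omega>. \<forall>F\<in>K. \<omega> \<in> F \<longleftrightarrow> F \<in> J} \<in> G"
  using assms(2,3)
proof (induction K)
  interpret algebra \<Omega> G by fact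
  case empty
  show ?case using top by simp
next
  interpret algebra \<Omega> G by fact
  case (insert F K)
  have "{\<omega>\<in>\<Omega>. \<forall>F\<in>insert F K. \<omega> \<in> F \<longleftrightarrow> F \<in> J} =
      (if F \<in> J then F else \<Omega> - F) \<inter> {\<omega>\<in>\<Omega>. \<forall>F\<in>K. \<omega> \<in> F \<longleftrightarrow> F \<in> J}"
    by auto
  also have "\<dots> \<in> G"
    using insert by (intro Int) (auto intro: compl_sets)
  finally show ?case .
qed

text \<open>
  The finitely many sets generate a finite algebra. Moving the mass of each of its nonempty atoms
  to a point of that atom leaves the mass of every set of this finite algebra unchanged, and sums
  of point masses are defined on all sets.
\<close>

lemma algebra_charge_matched_on_finite:
  assumes "algebra \<Omega> G" "\<nu> \<in> ba_plus G" "finite K" "K \<subseteq> G"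
  shows "\<exists>\<mu>\<in>ba_plus UNIV. \<mu> UNIV \<le> \<nu> \<Omega> \<and> (\<forall>F\<in>K. \<mu> F = \<nu> F)"
proof -
  interpret algebra \<Omega> G by fact
  have add: "Measure_Space.additive G \<nu>" and nn: "\<And>F. F \<in> G \<Longrightarrow> 0 \<le> \<nu> F"
    using assms(2) by (auto simp: ba_plus_def ba_def)
  have zero: "\<nu> {} = 0" using algebra_additive_empty[OF assms(1) add] .
  define a where "a J = {\<omega>\<in>\<Omega>. \<forall>F\<in>K. \<omega> \<in> F \<longleftrightarrow> F \<in> J}" for J
  define b where "b J = (SOME \<omega>. \<omega> \<in> a J)" for J
  define \<mu> where "\<mu> E = (\<Sum>J\<in>Pow K. \<nu> (a J) * indicator E (b J))" for E
  have aG: "a J \<in> G" for J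
    unfolding a_def using algebra_atom[OF assms(1,3,4)] .
  have b: "b J \<in> a J" if "a J \<noteq> {}" for J
    unfolding b_def using that by (simp add: some_in_eq)
  have split: "\<nu> F = (\<Sum>J\<in>Pow K. \<nu> (a J \<inter> F))" if "F \<in> G" for F
  proof -
    have "disjoint_family_on (\<lambda>J. a J \<inter> F) (Pow K)"
      unfolding disjoint_family_on_def a_def by blast
    then have "(\<Sum>J\<in>Pow K. \<nu> (a J \<inter> F)) = \<nu> (\<Union>J\<in>Pow K. a J \<inter> F)"
      using assms(3) aG that by (intro algebra_additive_sum[OF assms(1) add]) auto
    also have "(\<Union>J\<in>Pow K. a J \<inter> F) = F"
    proof
      show "F \<subseteq> (\<Union>J\<in>Pow K. a J \<inter> F)"
      proof
        fix \<omega> assume "\<omega> \<in> F"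
        then have "\<omega> \<in> \<Omega>" using that sets_into_space by blast
        then have "\<omega> \<in> a {F\<in>K. \<omega> \<in> F}" by (simp add: a_def)
        then show "\<omega> \<in> (\<Union>J\<in>Pow K. a J \<inter> F)" using \<open>\<omega> \<in> F\<close> by (intro UN_I[of "{F\<in>K. \<omega> \<in> F}"]) auto
      qed
    qed auto
    finally show ?thesis by simp
  qed
  have "\<mu> \<in> ba_plus UNIV"
  proof (rule ba_plus_UNIV_I)
    show "\<mu> (A \<union> B) = \<mu> A + \<mu> B" if "A \<inter> B = {}" for A B
    proof -
      have "indicator (A \<union> B) w = indicator A w + (indicator B w :: real)" for w
        using that by (auto simp: indicator_def)
      then show ?thesis by (simp add: \<mu>_def sum.distrib distrib_left)
    qed
    show "0 \<le> \<mu> E" for E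
      unfolding \<mu>_def using nn aG by (intro sum_nonneg mult_nonneg_nonneg) auto
  qed
  moreover have "\<mu> UNIV \<le> \<nu> \<Omega>"
  proof -
    have "a J \<inter> \<Omega> = a J" for J by (auto simp: a_def)
    then show ?thesis using split[OF top] by (simp add: \<mu>_def)
  qed
  moreover have "\<mu> F = \<nu> F" if "F \<in> K" for F
  proof -
    have "\<nu> (a J \<inter> F) = \<nu> (a J) * indicator F (b J)" for J
    proof (cases "a J = {}")
      case False
      then have bJ: "b J \<in> F \<longleftrightarrow> F \<in> J" using b that by (auto simp: a_def)
      have "a J \<inter> F = (if F \<in> J then a J else {})" using that by (auto simp: a_def)
      then show ?thesis using bJ zero by auto
    qed (simp add: zero)
    then show ?thesis using split[of F] that assms(4) by (auto simp: \<mu>_def)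
  qed
  ultimately show ?thesis by blast
qed

text \<open>
  The extension is made to vanish off \<open>\<Omega>\<close>, so that a charge assembled from such extensions has no
  mass outside \<open>\<Omega>\<close> and its total mass is read off from its value at \<open>\<Omega>\<close>.
\<close>

lemma algebra_charge_extension:
  assumes "algebra \<Omega> G" "\<nu> \<in> ba_plus G"
  shows "\<exists>\<mu>\<in>ba_plus UNIV. (\<forall>F\<in>G. \<mu> F = \<nu> F) \<and> (\<forall>E. E \<inter> \<Omega> = {} \<longrightarrow> \<mu> E = 0)"
proof -
  have "\<exists>x\<in>ba_plus UNIV. \<forall>F\<in>G. x F = \<nu> F"
    by (rule ba_plus_prescribed_values_compact) (rule algebra_charge_matched_on_finite[OF assms])
  then obtain x where x: "x \<in> ba_plus UNIV" and xG: "\<And>F. F \<in> G \<Longrightarrow> x F = \<nu> F"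
    by blast
  have x0: "x {} = 0" using ba_plus_UNIV_Un[OF x, of "{}" "{}"] by simp
  show ?thesis
  proof (intro bexI[of _ "\<lambda>E. x (E \<inter> \<Omega>)"] conjI ballI allI impI)
    show "(\<lambda>E. x (E \<inter> \<Omega>)) \<in> ba_plus UNIV"
    proof (rule ba_plus_UNIV_I)
      show "x ((A \<union> B) \<inter> \<Omega>) = x (A \<inter> \<Omega>) + x (B \<inter> \<Omega>)" if "A \<inter> B = {}" for A B
        unfolding Int_Un_distrib2 using that by (intro ba_plus_UNIV_Un[OF x]) blast
    qed (rule ba_plus_UNIV_nonneg[OF x])
    show "x (F \<inter> \<Omega>) = \<nu> F" if "F \<in> G" for F
    proof -
      interpret algebra \<Omega> G by fact
      have "F \<inter> \<Omega> = F" using that sets_into_space by blast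
      then show ?thesis using xG that by simp
    qed
    show "x (E \<inter> \<Omega>) = 0" if "E \<inter> \<Omega> = {}" for E
      using that x0 by simp
  qed
qed

section \<open>The charge on the product representing a decreasing family\<close>

lemma greaterThanLessThan_ennreal_mono:
  "t \<le> u \<Longrightarrow> {ennreal u<..<\<infinity>} \<subseteq> {ennreal t<..<\<infinity>}"
  using ennreal_leI[of t u] by auto

text \<open>
  For times \<open>t\<^sub>1 < \<dots> < t\<^sub>n\<close>, the decrement \<open>\<eta> t\<^sub>k - \<eta> t\<^sub>k\<^sub>+\<^sub>1\<close> is a positive charge on \<open>\<A> t\<^sub>k\<close>, where
  \<open>0\<close> takes the role of \<open>\<eta> t\<^sub>n\<^sub>+\<^sub>1\<close>. Extend it to all sets and place it on the slice at some time
  after \<open>t\<^sub>k\<close> and, if \<open>k < n\<close>, before \<open>t\<^sub>k\<^sub>+\<^sub>1\<close>. The mass that lies after \<open>t\<^sub>j\<close> then telescopes to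
  \<open>\<eta> t\<^sub>j\<close>. The induction adds a new earliest time, which leaves the masses after the later times
  untouched; for the new time to see nothing more of the old charge than the previous earliest
  time did, the charge is also required to vanish off the strips after the given times.
\<close>

lemma decreasing_charges_represented_finite:
  assumes "algebra_filtration \<Omega> \<A>"
    and \<eta>: "\<And>t. 0 \<le> t \<Longrightarrow> \<eta> t \<in> ba_plus (\<A> t)"
    and dec: "\<And>t u F. 0 \<le> t \<Longrightarrow> t \<le> u \<Longrightarrow> F \<in> \<A> t \<Longrightarrow> \<eta> u F \<le> \<eta> t F"
    and "finite T" "T \<subseteq> {0..}"
  shows "\<exists>x\<in>ba_plus UNIV.
    (\<forall>t\<in>T. \<forall>F\<in>\<A> t. x (F \<times> {ennreal t<..<\<infinity>}) = \<eta> t F) \<and>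
    (\<forall>E. E \<inter> (\<Union>t\<in>T. \<Omega> \<times> {ennreal t<..<\<infinity>}) = {} \<longrightarrow> x E = 0)"
  using assms(4,5)
proof (induction T rule: finite_linorder_min_induct)
  case empty
  have "(\<lambda>_. 0) \<in> ba_plus UNIV" by (rule ba_plus_UNIV_I) auto
  then show ?case by auto
next
  case (insert t T)
  interpret algebra_filtration \<Omega> \<A> by fact
  have t: "0 \<le> t" and T: "T \<subseteq> {0..}" using insert.prems by auto
  interpret At: algebra \<Omega> "\<A> t" using algebra[OF t] .
  obtain x where x: "x \<in> ba_plus UNIV"
    and x\<eta>: "\<And>u F. u \<in> T \<Longrightarrow> F \<in> \<A> u \<Longrightarrow> x (F \<times> {ennreal u<..<\<infinity>}) = \<eta> u F"
    and x0: "\<And>E. E \<inter> (\<Union>u\<in>T. \<Omega> \<times> {ennreal u<..<\<infinity>}) = {} \<Longrightarrow> x E = 0"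
    using insert.IH[OF T] by blast
  \<comment> \<open>The charge that remains at the next time; nothing remains after the last one.\<close>
  define \<gamma> where "\<gamma> F = (if T = {} then 0 else \<eta> (Min T) F)" for F
  obtain s where s: "t < s" "\<And>u. u \<in> T \<Longrightarrow> s < u"
  proof (cases "T = {}")
    case True
    then show ?thesis using that[of "t + 1"] by auto
  next
    case False
    then have "t < Min T" using insert.hyps by simp
    then obtain s where "t < s" "s < Min T" using dense by blast
    then show ?thesis using that[of s] insert.hyps(1) False by auto
  qed
  \<comment> \<open>The old charge has no mass between \<open>t\<close> and the earliest time of \<open>T\<close>.\<close>
  have x\<gamma>: "x (F \<times> {ennreal t<..<\<infinity>}) = \<gamma> F" if F: "F \<in> \<A> t" for F
  proof (cases "T = {}")
    case True
    then show ?thesis using x0 by (simp add: \<gamma>_def)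
  next
    case False
    let ?m = "Min T"
    have m: "?m \<in> T" "t < ?m" "\<And>u. u \<in> T \<Longrightarrow> ?m \<le> u"
      using False insert.hyps by auto
    have sub: "{ennreal ?m<..<\<infinity>} \<subseteq> {ennreal t<..<\<infinity>}"
      using m(2) by (intro greaterThanLessThan_ennreal_mono) simp
    have "F \<in> \<A> ?m" using F increasing[OF t, of ?m] m(2) by auto
    have "x (F \<times> ({ennreal t<..<\<infinity>} - {ennreal ?m<..<\<infinity>})) = 0"
    proof (rule x0)
      have "{ennreal u<..<\<infinity>} \<subseteq> {ennreal ?m<..<\<infinity>}" if "u \<in> T" for u
        using m(3)[OF that] by (rule greaterThanLessThan_ennreal_mono)
      then show "F \<times> ({ennreal t<..<\<infinity>} - {ennreal ?m<..<\<infinity>}) \<inter>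
          (\<Union>u\<in>T. \<Omega> \<times> {ennreal u<..<\<infinity>}) = {}"
        by blast
    qed
    moreover have "F \<times> {ennreal t<..<\<infinity>} =
        F \<times> {ennreal ?m<..<\<infinity>} \<union> F \<times> ({ennreal t<..<\<infinity>} - {ennreal ?m<..<\<infinity>})"
      using sub by blast
    ultimately have "x (F \<times> {ennreal t<..<\<infinity>}) = x (F \<times> {ennreal ?m<..<\<infinity>})"
      using ba_plus_UNIV_Un[OF x, of "F \<times> {ennreal ?m<..<\<infinity>}"
          "F \<times> ({ennreal t<..<\<infinity>} - {ennreal ?m<..<\<infinity>})"] by auto
    then show ?thesis using x\<eta>[OF m(1) \<open>F \<in> \<A> ?m\<close>] False by (simp add: \<gamma>_def)
  qed
  have "(\<lambda>F. \<eta> t F - \<gamma> F) \<in> ba_plus (\<A> t)"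
  proof -
    have add: "Measure_Space.additive (\<A> t) (\<eta> t)" and bd: "bounded (\<eta> t ` \<A> t)"
      using \<eta>[OF t] by (auto simp: ba_plus_def ba_def)
    have "\<gamma> (A \<union> B) = \<gamma> A + \<gamma> B" if "A \<in> \<A> t" "B \<in> \<A> t" "A \<inter> B = {}" for A B
    proof -
      let ?I = "{ennreal t<..<\<infinity>}"
      have "x ((A \<union> B) \<times> ?I) = x (A \<times> ?I \<union> B \<times> ?I)"
        by (rule arg_cong[where f = x]) auto
      also have "\<dots> = x (A \<times> ?I) + x (B \<times> ?I)"
        using that(3) by (intro ba_plus_UNIV_Un[OF x]) auto
      finally show ?thesis
        unfolding x\<gamma>[OF that(1)] x\<gamma>[OF that(2)] x\<gamma>[OF At.Un[OF that(1,2)]] .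
    qed
    moreover have "0 \<le> \<gamma> F" "\<gamma> F \<le> \<eta> t F" if "F \<in> \<A> t" for F
    proof -
      show "0 \<le> \<gamma> F" using x\<gamma>[OF that] ba_plus_UNIV_nonneg[OF x] by metis
      show "\<gamma> F \<le> \<eta> t F"
      proof (cases "T = {}")
        case True
        then show ?thesis using \<eta>[OF t] that by (auto simp: \<gamma>_def ba_plus_def)
      next
        case False
        then have "t \<le> Min T" using insert.hyps by (auto intro: less_imp_le)
        then show ?thesis using dec[OF t _ that] False by (simp add: \<gamma>_def)
      qed
    qed
    moreover obtain C where C: "\<And>F. F \<in> \<A> t \<Longrightarrow> \<bar>\<eta> t F\<bar> \<le> C"
      using bd by (auto simp: bounded_iff)
    ultimately have "bounded ((\<lambda>F. \<eta> t F - \<gamma> F) ` \<A> t)"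
      unfolding bounded_iff by (auto intro!: exI[of _ C]) (smt (verit))
    moreover have "Measure_Space.additive (\<A> t) (\<lambda>F. \<eta> t F - \<gamma> F)"
      using add \<open>\<And>A B. A \<in> \<A> t \<Longrightarrow> B \<in> \<A> t \<Longrightarrow> A \<inter> B = {} \<Longrightarrow> \<gamma> (A \<union> B) = \<gamma> A + \<gamma> B\<close>
      by (auto simp: Measure_Space.additive_def)
    ultimately show ?thesis
      using \<open>\<And>F. F \<in> \<A> t \<Longrightarrow> \<gamma> F \<le> \<eta> t F\<close> by (auto simp: ba_plus_def ba_def)
  qed
  from algebra_charge_extension[OF algebra[OF t] this]
  obtain \<mu> where \<mu>: "\<mu> \<in> ba_plus UNIV"
    and \<mu>F: "\<And>F. F \<in> \<A> t \<Longrightarrow> \<mu> F = \<eta> t F - \<gamma> F"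
    and \<mu>0: "\<And>E. E \<inter> \<Omega> = {} \<Longrightarrow> \<mu> E = 0"
    by blast
  define slice where "slice E = {\<omega>. (\<omega>, ennreal s) \<in> E}" for E :: "('a \<times> ennreal) set"
  define y where "y E = x E + \<mu> (slice E)" for E
  have slice_prod: "slice (F \<times> {ennreal u<..<\<infinity>}) = (if u < s then F else {})"
    if "0 \<le> u" for u F
    using that s(1) t by (auto simp: slice_def ennreal_less_iff)
  have "y \<in> ba_plus UNIV"
  proof (rule ba_plus_UNIV_I)
    show "y (A \<union> B) = y A + y B" if "A \<inter> B = {}" for A B
    proof -
      have "slice (A \<union> B) = slice A \<union> slice B" "slice A \<inter> slice B = {}"
        using that by (auto simp: slice_def)
      then show ?thesis
        using ba_plus_UNIV_Un[OF x that] ba_plus_UNIV_Un[OF \<mu>] by (simp add: y_def)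
    qed
    show "0 \<le> y E" for E
      unfolding y_def by (intro add_nonneg_nonneg ba_plus_UNIV_nonneg x \<mu>)
  qed
  moreover have "y (F \<times> {ennreal u<..<\<infinity>}) = \<eta> u F" if "u \<in> insert t T" "F \<in> \<A> u" for u F
  proof (cases "u \<in> T")
    case True
    then have "\<not> u < s" "0 \<le> u" using s(2)[OF True] T by auto
    then show ?thesis using x\<eta>[OF True that(2)] \<mu>0[of "{}"] slice_prod by (simp add: y_def)
  next
    case False
    then have "u = t" using that by simp
    then show ?thesis using x\<gamma> \<mu>F that(2) slice_prod[OF t] s(1) by (simp add: y_def)
  qed
  moreover have "y E = 0"
    if E: "E \<inter> (\<Union>u\<in>insert t T. \<Omega> \<times> {ennreal u<..<\<infinity>}) = {}" for E
  proof -
    have "x E = 0" using E by (intro x0) blast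
    moreover have "ennreal s \<in> {ennreal t<..<\<infinity>}"
      using s(1) t by (simp add: ennreal_less_iff)
    then have "slice E \<inter> \<Omega> = {}" using E unfolding slice_def by blast
    ultimately show ?thesis using \<mu>0 by (simp add: y_def)
  qed
  ultimately show ?case by (intro bexI[of _ y] conjI ballI allI impI)
qed

lemma decreasing_charges_represented:
  assumes "algebra_filtration \<Omega> \<A>"
    and "\<And>t. 0 \<le> t \<Longrightarrow> \<eta> t \<in> ba_plus (\<A> t)"
    and "\<And>t u F. 0 \<le> t \<Longrightarrow> t \<le> u \<Longrightarrow> F \<in> \<A> t \<Longrightarrow> \<eta> u F \<le> \<eta> t F"
  shows "\<exists>x\<in>ba_plus UNIV. \<forall>t\<ge>0. \<forall>F\<in>\<A> t. x (F \<times> {ennreal t<..<\<infinity>}) = \<eta> t F"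
proof -
  interpret algebra_filtration \<Omega> \<A> by fact
  interpret A0: algebra \<Omega> "\<A> 0" by (rule algebra) simp
  let ?I = "{(t, F). 0 \<le> t \<and> F \<in> \<A> t}"
  have "\<exists>x\<in>ba_plus UNIV. \<forall>i\<in>?I. x (case i of (t, F) \<Rightarrow> F \<times> {ennreal t<..<\<infinity>}) =
      (case i of (t, F) \<Rightarrow> \<eta> t F)"
  proof (rule ba_plus_prescribed_values_compact[where B = "\<eta> 0 \<Omega>"])
    fix K assume K: "finite K" "K \<subseteq> ?I"
    \<comment> \<open>Including time \<open>0\<close> fixes the total mass, which bounds the charges independently of \<open>K\<close>.\<close>
    define T where "T = insert 0 (fst ` K)"
    have "finite T" and T0: "T \<subseteq> {0..}" using K by (auto simp: T_def)
    then obtain x where x: "x \<in> ba_plus UNIV"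
      and x\<eta>: "\<And>u F. u \<in> T \<Longrightarrow> F \<in> \<A> u \<Longrightarrow> x (F \<times> {ennreal u<..<\<infinity>}) = \<eta> u F"
      and x0: "\<And>E. E \<inter> (\<Union>u\<in>T. \<Omega> \<times> {ennreal u<..<\<infinity>}) = {} \<Longrightarrow> x E = 0"
      using decreasing_charges_represented_finite[OF assms, of T] by blast
    let ?D = "\<Omega> \<times> {ennreal 0<..<\<infinity>}"
    have "x (- ?D) = 0"
    proof (rule x0)
      have "{ennreal u<..<\<infinity>} \<subseteq> {ennreal 0<..<\<infinity>}" if "u \<in> T" for u
        using that T0 by (intro greaterThanLessThan_ennreal_mono) auto
      then show "- ?D \<inter> (\<Union>u\<in>T. \<Omega> \<times> {ennreal u<..<\<infinity>}) = {}" by blast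
    qed
    then have "x UNIV = \<eta> 0 \<Omega>"
      using ba_plus_UNIV_Un[OF x, of ?D "- ?D"] x\<eta>[of 0 \<Omega>] by (simp add: T_def)
    moreover have "x (case i of (t, F) \<Rightarrow> F \<times> {ennreal t<..<\<infinity>}) =
        (case i of (t, F) \<Rightarrow> \<eta> t F)" if "i \<in> K" for i
    proof -
      obtain t F where i: "i = (t, F)" by force
      then have "F \<in> \<A> t" using that K(2) by blast
      moreover have "t \<in> T" using image_eqI[OF _ that, of t fst] by (simp add: i T_def)
      ultimately show ?thesis using x\<eta> by (simp add: i)
    qed
    ultimately show "\<exists>x\<in>ba_plus UNIV. x UNIV \<le> \<eta> 0 \<Omega> \<and>
        (\<forall>i\<in>K. x (case i of (t, F) \<Rightarrow> F \<times> {ennreal t<..<\<infinity>}) = (case i of (t, F) \<Rightarrow> \<eta> t F))"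
      using x by (intro bexI[of _ x]) auto
  qed
  then obtain x where x: "x \<in> ba_plus UNIV"
    and x\<eta>: "\<forall>i\<in>?I. x (case i of (t, F) \<Rightarrow> F \<times> {ennreal t<..<\<infinity>}) =
      (case i of (t, F) \<Rightarrow> \<eta> t F)" ..
  have "x (F \<times> {ennreal t<..<\<infinity>}) = \<eta> t F" if "0 \<le> t" "F \<in> \<A> t" for t F
    using bspec[OF x\<eta>, of "(t, F)"] that by simp
  with x show ?thesis by (intro bexI[of _ x]) simp_all
qed

section \<open>Limits of supermartingales and the decomposition\<close>

lemma antimono_bounded_tendsto_Lim:
  fixes f :: "real \<Rightarrow> real"
  assumes dec: "\<And>t u. a \<le> t \<Longrightarrow> t \<le> u \<Longrightarrow> f u \<le> f t" and bd: "\<And>t. a \<le> t \<Longrightarrow> C \<le> f t"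
  shows "(f \<longlongrightarrow> Lim at_top f) at_top" and "\<And>t. a \<le> t \<Longrightarrow> Lim at_top f \<le> f t"
proof -
  let ?l = "INF t\<in>{a..}. f t"
  have bb: "bdd_below (f ` {a..})" using bd by (auto intro!: bdd_belowI)
  have "(f \<longlongrightarrow> ?l) at_top"
  proof (rule order_tendstoI)
    fix c assume "c < ?l"
    have "c < f t" if "a \<le> t" for t
      using \<open>c < ?l\<close> cINF_lower[OF bb, of t] that by simp
    then show "\<forall>\<^sub>F t in at_top. c < f t"
      using eventually_at_top_linorder by blast
  next
    fix c assume "?l < c"
    then obtain t0 where t0: "a \<le> t0" "f t0 < c"
      using bb by (subst (asm) cINF_less_iff) auto
    then have "f t < c" if "t0 \<le> t" for t using dec[OF t0(1) that] by simp
    then show "\<forall>\<^sub>F t in at_top. f t < c"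
      using eventually_at_top_linorder by blast
  qed
  moreover from this have "Lim at_top f = ?l"
    by (intro tendsto_Lim) auto
  ultimately show "(f \<longlongrightarrow> Lim at_top f) at_top" and "\<And>t. a \<le> t \<Longrightarrow> Lim at_top f \<le> f t"
    using cINF_lower[OF bb] by auto
qed

lemma bounded_fa_supermartingale_bound:
  assumes "\<xi> \<in> bounded_fa_supermartingale \<A>"
  obtains C where "\<And>t F. 0 \<le> t \<Longrightarrow> F \<in> \<A> t \<Longrightarrow> \<bar>\<xi> t F\<bar> \<le> C"
proof -
  let ?S = "SUP t\<in>{0..}. tv_norm (\<A> t) (\<xi> t)"
  have fin: "?S < \<infinity>"
    using assms by (simp add: bounded_fa_supermartingale_def)
  have "\<bar>\<xi> t F\<bar> \<le> enn2real ?S" if "0 \<le> t" "F \<in> \<A> t" for t F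
  proof -
    have "ennreal \<bar>\<xi> t F\<bar> \<le> tv_norm (\<A> t) (\<xi> t)"
      unfolding tv_norm_def using that by (intro SUP_upper2[of "{F}"]) (auto simp: disjoint_def)
    also have "\<dots> \<le> ?S" using that by (intro SUP_upper) auto
    finally have "ennreal \<bar>\<xi> t F\<bar> \<le> ennreal (enn2real ?S)" using fin by simp
    then show ?thesis by (subst (asm) ennreal_le_iff) auto
  qed
  then show thesis using that by blast
qed

text \<open>
  The limit charge lives on \<open>alg_infinity \<A>\<close>: any two of its members belong to a common
  \<open>\<A> t\<close>, from time \<open>t\<close> on the process is additive there, and additivity passes to the limit.
\<close>

lemma bounded_fa_supermartingale_limit:
  assumes "algebra_filtration \<Omega> \<A>" and \<xi>: "\<xi> \<in> bounded_fa_supermartingale \<A>"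
  obtains \<mu> where "\<mu> \<in> ba (alg_infinity \<A>)"
    and "\<And>t F. 0 \<le> t \<Longrightarrow> F \<in> \<A> t \<Longrightarrow> ((\<lambda>t. \<xi> t F) \<longlongrightarrow> \<mu> F) at_top"
    and "\<And>t F. 0 \<le> t \<Longrightarrow> F \<in> \<A> t \<Longrightarrow> \<mu> F \<le> \<xi> t F"
proof -
  interpret algebra_filtration \<Omega> \<A> by fact
  have dec: "\<xi> u F \<le> \<xi> t F" if "0 \<le> t" "t \<le> u" "F \<in> \<A> t" for t u F
    using \<xi> that by (auto simp: bounded_fa_supermartingale_def fa_supermartingale_def)
  have add: "Measure_Space.additive (\<A> t) (\<xi> t)" if "0 \<le> t" for t
    using \<xi> that
    by (auto simp: bounded_fa_supermartingale_def fa_supermartingale_def fa_process_def ba_def)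
  obtain C where C: "\<And>t F. 0 \<le> t \<Longrightarrow> F \<in> \<A> t \<Longrightarrow> \<bar>\<xi> t F\<bar> \<le> C"
    using bounded_fa_supermartingale_bound[OF \<xi>] by blast
  define \<mu> where "\<mu> F = Lim at_top (\<lambda>t. \<xi> t F)" for F
  have mono: "F \<in> \<A> u" if "0 \<le> t" "t \<le> u" "F \<in> \<A> t" for t u F
    using increasing that by blast
  have decF: "\<xi> v F \<le> \<xi> u F" if "0 \<le> t" "F \<in> \<A> t" "t \<le> u" "u \<le> v" for t u v F
    using dec[of u v F] mono[OF that(1,3,2)] that by auto
  have lower: "- C \<le> \<xi> u F" if "0 \<le> t" "F \<in> \<A> t" "t \<le> u" for t u F
    using C[of u F] mono[OF that(1,3,2)] that by auto
  have lim: "((\<lambda>t. \<xi> t F) \<longlongrightarrow> \<mu> F) at_top" and le: "\<mu> F \<le> \<xi> t F"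
    if "0 \<le> t" "F \<in> \<A> t" for t F
    using antimono_bounded_tendsto_Lim[of t "\<lambda>u. \<xi> u F" "- C"] decF[OF that] lower[OF that]
    by (auto simp: \<mu>_def)
  have "\<mu> \<in> ba (alg_infinity \<A>)"
    unfolding ba_def
  proof (intro CollectI conjI)
    show "Measure_Space.additive (alg_infinity \<A>) \<mu>"
      unfolding Measure_Space.additive_def
    proof (intro ballI impI)
      fix F G assume "F \<in> alg_infinity \<A>" "G \<in> alg_infinity \<A>" and disj: "F \<inter> G = {}"
      then obtain t1 t2 where F0: "0 \<le> t1" "F \<in> \<A> t1" "0 \<le> t2" "G \<in> \<A> t2"
        by (auto simp: alg_infinity_def)
      define t where "t = max t1 t2"
      have t: "0 \<le> t" "F \<in> \<A> t" "G \<in> \<A> t"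
        using mono[of t1 t F] mono[of t2 t G] F0 by (auto simp: t_def)
      interpret algebra \<Omega> "\<A> t" using algebra t(1) .
      have "\<xi> u F + \<xi> u G = \<xi> u (F \<union> G)" if "t \<le> u" for u
        using additiveD[OF add[of u] disj] mono[OF t(1) that] t that by auto
      then have ev: "\<forall>\<^sub>F u in at_top. \<xi> u F + \<xi> u G = \<xi> u (F \<union> G)"
        using eventually_at_top_linorder by blast
      have "((\<lambda>u. \<xi> u F + \<xi> u G) \<longlongrightarrow> \<mu> F + \<mu> G) at_top"
        by (intro tendsto_add lim[OF t(1)] t(2,3))
      then have "((\<lambda>u. \<xi> u (F \<union> G)) \<longlongrightarrow> \<mu> F + \<mu> G) at_top"
        using tendsto_cong[OF ev] by simp
      moreover have "((\<lambda>u. \<xi> u (F \<union> G)) \<longlongrightarrow> \<mu> (F \<union> G)) at_top"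
        by (rule lim[OF t(1)]) (use t in auto)
      ultimately show "\<mu> (F \<union> G) = \<mu> F + \<mu> G"
        using tendsto_unique[OF trivial_limit_at_top_linorder] by metis
    qed
    have "\<bar>\<mu> F\<bar> \<le> C" if F: "F \<in> alg_infinity \<A>" for F
    proof -
      obtain t where t: "0 \<le> t" "F \<in> \<A> t" using F by (auto simp: alg_infinity_def)
      have "- C \<le> \<mu> F"
        using lower[OF t]
        by (intro tendsto_lowerbound[OF lim[OF t]]) (auto simp: eventually_at_top_linorder)
      then show ?thesis using le[OF t] C[OF t] by auto
    qed
    then show "bounded (\<mu> ` alg_infinity \<A>)" by (auto simp: bounded_iff)
  qed
  with lim le show thesis using that by blast
qed

theorem theorem2:
  fixes \<Omega> :: "'a set" and \<A> :: "real \<Rightarrow> 'a set set" and \<xi> :: "real \<Rightarrow> 'a set \<Rightarrow> real"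
  assumes "algebra_filtration \<Omega> \<A>"
    and "\<xi> \<in> fa_process \<A>"
  shows "\<xi> \<in> bounded_fa_supermartingale \<A> \<longleftrightarrow>
    (\<exists>x \<in> frakM \<Omega>. \<exists>\<mu> \<in> ba (alg_infinity \<A>).
      \<forall>t\<ge>0. \<forall>F\<in>\<A> t. \<xi> t F = \<mu> F + x (F \<times> {ennreal t<..<\<infinity>}))"
proof
  interpret algebra_filtration \<Omega> \<A> by fact
  assume \<xi>: "\<xi> \<in> bounded_fa_supermartingale \<A>"
  obtain \<mu> where \<mu>: "\<mu> \<in> ba (alg_infinity \<A>)"
    and lim: "\<And>t F. 0 \<le> t \<Longrightarrow> F \<in> \<A> t \<Longrightarrow> ((\<lambda>t. \<xi> t F) \<longlongrightarrow> \<mu> F) at_top"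
    and le: "\<And>t F. 0 \<le> t \<Longrightarrow> F \<in> \<A> t \<Longrightarrow> \<mu> F \<le> \<xi> t F"
    using bounded_fa_supermartingale_limit[OF assms(1) \<xi>] by blast
  define \<eta> where "\<eta> t F = \<xi> t F - \<mu> F" for t F
  have "\<eta> t \<in> ba_plus (\<A> t)" if t: "0 \<le> t" for t
  proof -
    have sub: "\<A> t \<subseteq> alg_infinity \<A>" using t by (auto simp: alg_infinity_def)
    have "bounded (\<xi> t ` \<A> t)" "bounded (\<mu> ` \<A> t)"
      using assms(2) t \<mu> bounded_subset[OF _ image_mono[OF sub]]
      by (auto simp: fa_process_def ba_def)
    then obtain C D where "\<And>F. F \<in> \<A> t \<Longrightarrow> \<bar>\<xi> t F\<bar> \<le> C" "\<And>F. F \<in> \<A> t \<Longrightarrow> \<bar>\<mu> F\<bar> \<le> D"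
      by (auto simp: bounded_iff)
    then have "\<And>F. F \<in> \<A> t \<Longrightarrow> \<bar>\<eta> t F\<bar> \<le> C + D"
      unfolding \<eta>_def by (smt (verit))
    then have "bounded (\<eta> t ` \<A> t)" by (auto simp: bounded_iff)
    moreover have "Measure_Space.additive (\<A> t) (\<eta> t)"
    proof -
      have "Measure_Space.additive (\<A> t) (\<xi> t)" "Measure_Space.additive (\<A> t) \<mu>"
        using assms(2) t \<mu> sub
        by (auto simp: fa_process_def ba_def Measure_Space.additive_def subset_iff)
      then show ?thesis by (auto simp: Measure_Space.additive_def \<eta>_def)
    qed
    ultimately show ?thesis using le[OF t] by (auto simp: ba_plus_def ba_def \<eta>_def)
  qed
  moreover have "\<eta> u F \<le> \<eta> t F" if "0 \<le> t" "t \<le> u" "F \<in> \<A> t" for t u F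
    using \<xi> that by (auto simp: bounded_fa_supermartingale_def fa_supermartingale_def \<eta>_def)
  ultimately obtain x where x: "x \<in> ba_plus UNIV"
    and x\<eta>: "\<And>t F. 0 \<le> t \<Longrightarrow> F \<in> \<A> t \<Longrightarrow> x (F \<times> {ennreal t<..<\<infinity>}) = \<eta> t F"
    using decreasing_charges_represented[OF assms(1), of \<eta>] by blast
  have \<Omega>A: "\<Omega> \<in> \<A> t" if "0 \<le> t" for t
    using algebra[OF that] by (rule algebra.top)
  have "x \<in> frakM \<Omega>"
    unfolding frakM_def
  proof (intro CollectI conjI)
    have "bounded (x ` Pow (Omega_bar \<Omega>))"
      using x by (auto simp: ba_plus_def ba_def intro: bounded_subset)
    then show "x \<in> ba_plus (Pow (Omega_bar \<Omega>))"
      using x by (auto simp: ba_plus_def ba_def Measure_Space.additive_def)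
    have "((\<lambda>t. \<eta> t \<Omega>) \<longlongrightarrow> \<mu> \<Omega> - \<mu> \<Omega>) at_top"
      unfolding \<eta>_def by (intro tendsto_diff tendsto_const lim[of 0] \<Omega>A) auto
    moreover have "\<forall>\<^sub>F t in at_top. \<eta> t \<Omega> = x (\<Omega> \<times> {ennreal t<..<\<infinity>})"
      using eventually_ge_at_top[of 0] by eventually_elim (rule x\<eta>[symmetric, OF _ \<Omega>A])
    ultimately show "((\<lambda>t. x (\<Omega> \<times> {ennreal t<..<\<infinity>})) \<longlongrightarrow> 0) at_top"
      using tendsto_cong by force
  qed
  moreover have "\<forall>t\<ge>0. \<forall>F\<in>\<A> t. \<xi> t F = \<mu> F + x (F \<times> {ennreal t<..<\<infinity>})"
    using x\<eta> by (simp add: \<eta>_def)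
  ultimately show "\<exists>x \<in> frakM \<Omega>. \<exists>\<mu> \<in> ba (alg_infinity \<A>).
      \<forall>t\<ge>0. \<forall>F\<in>\<A> t. \<xi> t F = \<mu> F + x (F \<times> {ennreal t<..<\<infinity>})"
    using \<mu> by blast
next
  interpret algebra_filtration \<Omega> \<A> by fact
  assume "\<exists>x \<in> frakM \<Omega>. \<exists>\<mu> \<in> ba (alg_infinity \<A>).
      \<forall>t\<ge>0. \<forall>F\<in>\<A> t. \<xi> t F = \<mu> F + x (F \<times> {ennreal t<..<\<infinity>})"
  then obtain x \<mu> where x: "x \<in> ba_plus (Pow (Omega_bar \<Omega>))" and \<mu>: "\<mu> \<in> ba (alg_infinity \<A>)"
    and eq: "\<And>t F. 0 \<le> t \<Longrightarrow> F \<in> \<A> t \<Longrightarrow> \<xi> t F = \<mu> F + x (F \<times> {ennreal t<..<\<infinity>})"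
    by (auto simp: frakM_def)
  have xadd: "x (A \<union> B) = x A + x B"
    if "A \<subseteq> \<Omega> \<times> UNIV" "B \<subseteq> \<Omega> \<times> UNIV" "A \<inter> B = {}" for A B
    using x that by (auto simp: ba_plus_def ba_def Measure_Space.additive_def Omega_bar_def)
  have xnn: "0 \<le> x A" if "A \<subseteq> \<Omega> \<times> UNIV" for A
    using x that by (auto simp: ba_plus_def Omega_bar_def)
  have into: "F \<subseteq> \<Omega>" if "0 \<le> t" "F \<in> \<A> t" for t F
  proof -
    interpret algebra \<Omega> "\<A> t" using algebra that(1) .
    show ?thesis using sets_into_space that(2) .
  qed
  have dec: "\<xi> u F \<le> \<xi> t F" if tu: "0 \<le> t" "t \<le> u" and F: "F \<in> \<A> t" for t u F
  proof -
    let ?A = "F \<times> {ennreal t<..<\<infinity>}" and ?B = "F \<times> {ennreal u<..<\<infinity>}"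
    have "?B \<subseteq> ?A" using greaterThanLessThan_ennreal_mono[OF tu(2)] by blast
    moreover have "?A \<subseteq> \<Omega> \<times> UNIV" using into[OF tu(1) F] by auto
    moreover from calculation have "?A = ?B \<union> (?A - ?B)" "?B \<subseteq> \<Omega> \<times> UNIV" "?A - ?B \<subseteq> \<Omega> \<times> UNIV"
      by auto
    ultimately have "x ?B \<le> x ?A"
      using xadd[of ?B "?A - ?B"] xnn[of "?A - ?B"] by (metis Diff_disjoint le_add_same_cancel1)
    moreover have "F \<in> \<A> u" using increasing[OF tu] F by blast
    ultimately show ?thesis using eq[of t F] eq[of u F] tu F by simp
  qed
  obtain C where C: "\<And>F. F \<in> alg_infinity \<A> \<Longrightarrow> \<bar>\<mu> F\<bar> \<le> C"
    using \<mu> by (auto simp: ba_def bounded_iff)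
  have "bounded (x ` Pow (\<Omega> \<times> UNIV))"
    using x by (simp add: ba_plus_def ba_def Omega_bar_def)
  then obtain D where D: "\<And>A. A \<subseteq> \<Omega> \<times> UNIV \<Longrightarrow> \<bar>x A\<bar> \<le> D"
    by (auto simp: bounded_iff)
  have "tv_norm (\<A> t) (\<xi> t) \<le> ennreal (2 * (C + D))" if t: "0 \<le> t" for t
  proof (rule tv_norm_le[OF algebra[OF t]])
    show "Measure_Space.additive (\<A> t) (\<xi> t)"
      using assms(2) t by (simp add: fa_process_def ba_def)
    fix F assume F: "F \<in> \<A> t"
    have "F \<in> alg_infinity \<A>" using F t by (auto simp: alg_infinity_def)
    moreover have "F \<times> {ennreal t<..<\<infinity>} \<subseteq> \<Omega> \<times> UNIV" using into[OF t F] by auto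
    ultimately show "\<bar>\<xi> t F\<bar> \<le> C + D"
      using C D eq[OF t F] by (smt (verit))
  qed
  then have "(SUP t\<in>{0..}. tv_norm (\<A> t) (\<xi> t)) \<le> ennreal (2 * (C + D))"
    by (intro SUP_least) auto
  also have "\<dots> < \<infinity>" by simp
  finally show "\<xi> \<in> bounded_fa_supermartingale \<A>"
    using assms(2) dec by (auto simp: bounded_fa_supermartingale_def fa_supermartingale_def)
qed

end
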